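(* For every integer $n>1$ there exists a graph $G_n$ on $n$ vertices with exactly $2n-3$ edges that has a canonical ESD labeling.
   Context: For a graph $G=(V,E)$ and $l\in\mathbb N$, a vertex labeling $\phi:V\to\{1,\dots,l\}$ is an edge-sum distinguishing (ESD) labeling if $\phi$ is injective and the edge-weights $w_\phi(uv)=\phi(u)+\phi(v)$ are pairwise distinct over all edges $uv\in E$. It is a canonical ESD labeling if $l=|V|$. Graphs are finite, simple, connected. *)

theory Defs
  imports Main "HOL-Library.FuncSet"
begin

text \<open>A graph is given by its vertex set and its set of edges, an edge being the unordered
  pair \<open>{u, v}\<close> of its two distinct endpoints.\<close>

definition simple_graph :: "'a set \<Rightarrow> 'a set set \<Rightarrow> bool" where
  "simple_graph V E \<longleftrightarrow> finite V \<and> (\<forall>e\<in>E. e \<subseteq> V \<and> card e = 2)"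

definition connected_graph :: "'a set \<Rightarrow> 'a set set \<Rightarrow> bool" where
  "connected_graph V E \<longleftrightarrow>
     V \<noteq> {} \<and> (\<forall>u\<in>V. \<forall>v\<in>V. (u, v) \<in> {(x, y). {x, y} \<in> E}\<^sup>*)"

text \<open>On an edge \<open>{u, v}\<close> with \<open>u \<noteq> v\<close> the sum below is \<open>\<phi> u + \<phi> v\<close>.\<close>

definition edge_weight :: "('a \<Rightarrow> nat) \<Rightarrow> 'a set \<Rightarrow> nat" where
  "edge_weight \<phi> e = (\<Sum>v\<in>e. \<phi> v)"

definition esd_labeling :: "'a set \<Rightarrow> 'a set set \<Rightarrow> nat \<Rightarrow> ('a \<Rightarrow> nat) \<Rightarrow> bool" where
  "esd_labeling V E l \<phi> \<longleftrightarrow>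
     \<phi> \<in> V \<rightarrow> {1..l} \<and> inj_on \<phi> V \<and> inj_on (edge_weight \<phi>) E"

definition canonical_esd_labeling :: "'a set \<Rightarrow> 'a set set \<Rightarrow> ('a \<Rightarrow> nat) \<Rightarrow> bool" where
  "canonical_esd_labeling V E \<phi> \<longleftrightarrow> esd_labeling V E (card V) \<phi>"

end

theory Submission
  imports Defs
begin

text \<open>Join both vertices \<open>1\<close> and \<open>n\<close> of \<open>{1..n}\<close> to all other vertices, and label by the
  identity. The edges at \<open>1\<close> have weights \<open>3, \<dots>, n + 1\<close> and the remaining edges at \<open>n\<close> have
  weights \<open>n + 2, \<dots>, 2n - 1\<close>, so each weight in \<open>{3..2n - 1}\<close> occurs exactly once.\<close>

definition weight_edge :: "nat \<Rightarrow> nat \<Rightarrow> nat set" where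
  "weight_edge n s = (if s \<le> n + 1 then {1, s - 1} else {s - n, n})"

text \<open>The bounds on \<open>s\<close> keep the endpoints distinct (\<open>s - 1\<close> \<ge>
  2, resp. \<open>s - n\<close> < \<open>n\<close>), so the sum over the set does not
  collapse.\<close>

lemma edge_weight_weight_edge:
  assumes "s \<in> {3..2 * n - 1}"
  shows "edge_weight id (weight_edge n s) = s"
  using assms by (auto simp: weight_edge_def edge_weight_def)

text \<open>Indexing edges by weight reduces counting them to counting an interval.\<close>

lemma inj_on_weight_edge: "inj_on (weight_edge n) {3..2 * n - 1}"
  by (rule inj_on_inverseI) (rule edge_weight_weight_edge)

lemma inj_on_edge_weight: "inj_on (edge_weight id) (weight_edge n ` {3..2 * n - 1})"
  by (rule inj_on_inverseI[where g = "weight_edge n"]) (auto simp: edge_weight_weight_edge)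

lemma simple_graph_weight_edges: "simple_graph {1..n} (weight_edge n ` {3..2 * n - 1})"
  by (auto simp: simple_graph_def weight_edge_def card_insert_if)

lemma connected_graph_weight_edges:
  assumes "n > 1"
  shows "connected_graph {1..n} (weight_edge n ` {3..2 * n - 1})"
proof -
  let ?R = "{(x, y). {x, y} \<in> weight_edge n ` {3..2 * n - 1}}"
  \<comment> \<open>The star at \<open>1\<close> already spans the graph.\<close>
  have hub: "(1, v) \<in> ?R\<^sup>*" if "v \<in> {1..n}" for v
  proof (cases "v = 1")
    case False
    \<comment> \<open>The weight \<open>v + 1\<close> is at most \<open>n + 1\<close>, hence in the
      first branch; \<open>v\<close> \<ge> 2 forces \<open>n + 1\<close> \<le>
      \<open>2 * n - 1\<close>.\<close>
    then have "{1, v} = weight_edge n (v + 1)" "v + 1 \<in> {3..2 * n - 1}"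
      using that by (auto simp: weight_edge_def)
    then show ?thesis by blast
  qed simp
  have "sym (?R\<^sup>*)"
    by (rule sym_rtrancl) (auto simp: sym_def insert_commute)
  then have "(u, v) \<in> ?R\<^sup>*" if "u \<in> {1..n}" "v \<in> {1..n}" for u v
    using hub[OF that(1)] hub[OF that(2)] by (meson rtrancl_trans symD)
  with assms show ?thesis
    unfolding connected_graph_def by auto
qed

theorem theorem2:
  fixes n :: nat
  assumes "n > 1"
  shows "\<exists>(V :: nat set) (E :: nat set set).
           simple_graph V E \<and> connected_graph V E \<and>
           card V = n \<and> card E = 2 * n - 3 \<and>
           (\<exists>\<phi>. canonical_esd_labeling V E \<phi>)"
proof (intro exI conjI)
  show "simple_graph {1..n} (weight_edge n ` {3..2 * n - 1})"
    by (rule simple_graph_weight_edges)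
  show "connected_graph {1..n} (weight_edge n ` {3..2 * n - 1})"
    using assms by (rule connected_graph_weight_edges)
  show "card (weight_edge n ` {3..2 * n - 1}) = 2 * n - 3"
    using card_image[OF inj_on_weight_edge, of n] assms by simp
  show "canonical_esd_labeling {1..n} (weight_edge n ` {3..2 * n - 1}) id"
    unfolding canonical_esd_labeling_def esd_labeling_def
    using inj_on_edge_weight by simp
qed simp

end
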